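(* Let $P\subset\mathbb{R}^d$ be a $d$-dimensional convex polytope (with the origin in its interior). If $P$ is first-order rigid, then $P$ is prestress stable; and if $P$ is prestress stable, then $P$ is second-order rigid.
   Context: Let $P$ have vertex set $V$, edge set $E$ and facet set $F$; write $i\sim\sigma$ if vertex $i$ lies on facet $\sigma$, and let $V\!F$ be the set of incident vertex-facet pairs. $P$ is identified with the pair $(\boldsymbol p,\boldsymbol a)$ of maps $\boldsymbol p:V\to\mathbb{R}^d$ (vertices) and $\boldsymbol a:F\to\mathbb{R}^d$ (outward facet normals), scaled such that $\langle p_i,a_\sigma\rangle=1$ for $i\sim\sigma$ and $\langle p_i,a_\sigma\rangle<1$ for $i\not\sim\sigma$. Rigidity matrix: for any pair of maps $(\boldsymbol q,\boldsymbol b)$, $\boldsymbol q:V\to\mathbb{R}^d$, $\boldsymbol b:F\to\mathbb{R}^d$, $\mathcal R(\boldsymbol q,\boldsymbol b)$ is the $(|E|+|V\!F|)\times(d|V|+d|F|)$ matrix of the linear map sending $(\dot{\boldsymbol p},\dot{\boldsymbol a})\in\mathbb{R}^{dV}\oplus\mathbb{R}^{dF}$ to the vector with entries $\langle q_i-q_j,\dot p_i-\dot p_j\rangle$ for $ij\in E$ and $\langle q_i,\dot a_\sigma\rangle+\langle\dot p_i,b_\sigma\rangle$ for $i\sim\sigma$. Set $\mathcal R(P)=\mathcal R(\boldsymbol p,\boldsymbol a)$, and for $\dot P=(\dot{\boldsymbol p},\dot{\boldsymbol a})$ set $\mathcal R(\dot P)=\mathcal R(\dot{\boldsymbol p},\dot{\boldsymbol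 a})$. A first-order motion of $P$ is an element $\dot P=(\dot{\boldsymbol p},\dot{\boldsymbol a})$ of $\ker\mathcal R(P)$; it is trivial if $\langle p_i-p_j,\dot p_i-\dot p_j\rangle=0$ for all $i,j\in V$. A first-order flex is a non-trivial first-order motion. $P$ is first-order rigid if it has no first-order flex. An equilibrium stress of $P$ is an element $\boldsymbol\xi\in\mathbb{R}^{E}\oplus\mathbb{R}^{V\!F}$ of $\ker\mathcal R(P)^\top$. A stress $\boldsymbol\xi$ blocks a first-order flex $\dot P$ if $\boldsymbol\xi^\top\mathcal R(\dot P)\dot P\neq0$. $P$ is prestress stable if there is a single stress $\boldsymbol\xi$ that blocks every first-order flex of $P$. A second-order motion of $P$ is a tuple $(\dot{\boldsymbol p},\dot{\boldsymbol a};\ddot{\boldsymbol p},\ddot{\boldsymbol a})$ such that $(\dot{\boldsymbol p},\dot{\boldsymbol a})$ is a first-order motion, $\langle p_i-p_j,\ddot p_i-\ddot p_j\rangle+\langle\dot p_i-\dot p_j,\dot p_i-\dot p_j\rangle=0$ for all $ij\in E$, and $\langle p_i,\ddot a_\sigma\rangle+2\langle\dot p_i,\dot a_\sigma\rangle+\langle\ddot p_i,a_\sigma\rangle=0$ for all $i\sim\sigma$. It is trivial if $(\dot{\boldsymbol p},\dot{\boldsymbol a})$ is trivial as a first-order motion. $P$ is second-order rigid if all its second-order motions are trivial. *)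

theory Defs
  imports "HOL-Analysis.Analysis"
begin

section \<open>Vertices, edges, facets and normals\<close>

text \<open>
  A polytope is a subset of \<open>real ^ 'd\<close>. Its vertices are indexed by themselves, so that the
  vertex map \<open>\<^bold>p\<close> is the identity; its facets are indexed by themselves as well. A pair of maps
  \<open>V \<rightarrow> \<real>\<^sup>d\<close>, \<open>F \<rightarrow> \<real>\<^sup>d\<close> is rendered by total functions, whose values outside \<open>V\<close> and \<open>F\<close> are
  never looked at.
\<close>

definition vertices :: "(real ^ 'd) set \<Rightarrow> (real ^ 'd) set" where
  "vertices P = {v. v extreme_point_of P}"

text \<open>Edges are represented by the unordered pairs of their end points.\<close>

definition edges :: "(real ^ 'd) set \<Rightarrow> (real ^ 'd) set set" where
  "edges P = {{i, j} | i j. i \<in> vertices P \<and> j \<in> vertices P \<and> closed_segment i j edge_of P}"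

definition facets :: "(real ^ 'd) set \<Rightarrow> (real ^ 'd) set set" where
  "facets P = {\<sigma>. \<sigma> facet_of P}"

definition incidences :: "(real ^ 'd) set \<Rightarrow> ((real ^ 'd) \<times> (real ^ 'd) set) set" where
  "incidences P = {(i, \<sigma>). i \<in> vertices P \<and> \<sigma> \<in> facets P \<and> i \<in> \<sigma>}"

definition is_facet_normal :: "(real ^ 'd) set \<Rightarrow> (real ^ 'd) set \<Rightarrow> real ^ 'd \<Rightarrow> bool" where
  "is_facet_normal P \<sigma> a \<longleftrightarrow>
     (\<forall>i\<in>vertices P. (i \<in> \<sigma> \<longrightarrow> i \<bullet> a = 1) \<and> (i \<notin> \<sigma> \<longrightarrow> i \<bullet> a < 1))"

text \<open>Well defined for a polytope with the origin in its interior, see \<open>ex1_facet_normal\<close> below.\<close>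

definition facet_normal :: "(real ^ 'd) set \<Rightarrow> (real ^ 'd) set \<Rightarrow> real ^ 'd" where
  "facet_normal P \<sigma> = (THE a. is_facet_normal P \<sigma> a)"

lemma finite_vertices: "polytope P \<Longrightarrow> finite (vertices P)"
  by (simp add: vertices_def finite_polyhedron_extreme_points polytope_imp_polyhedron)

lemma finite_facets: "polytope P \<Longrightarrow> finite (facets P)"
  by (simp add: facets_def finite_polytope_facets)

lemma ex1_facet_normal:
  fixes P :: "(real ^ 'd) set"
  assumes P: "polytope P" and 0: "0 \<in> interior P" and \<sigma>: "\<sigma> \<in> facets P"
  shows "\<exists>!a. is_facet_normal P \<sigma> a"
proof (rule ex_ex1I)
  have fo: "\<sigma> facet_of P" using \<sigma> by (simp add: facets_def)
  obtain c b where c: "c \<noteq> 0" and le: "P \<subseteq> {x. c \<bullet> x \<le> b}" and eq: "\<sigma> = P \<inter> {x. c \<bullet> x = b}"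
    using facet_of_polyhedron[OF polytope_imp_polyhedron[OF P] fo] .
  obtain e where e: "e > 0" "ball 0 e \<subseteq> P" using 0 by (auto simp: mem_interior)
  have "(e / 2 / norm c) *\<^sub>R c \<in> ball 0 e" using c e by simp
  then have "(e / 2 / norm c) *\<^sub>R c \<in> P" using e by blast
  then have "c \<bullet> ((e / 2 / norm c) *\<^sub>R c) \<le> b" using le by blast
  moreover have "c \<bullet> ((e / 2 / norm c) *\<^sub>R c) > 0" using c e by simp
  ultimately have b: "b > 0" by linarith
  have "is_facet_normal P \<sigma> ((1 / b) *\<^sub>R c)"
    unfolding is_facet_normal_def
  proof
    fix i assume "i \<in> vertices P"
    then have i: "i \<in> P" by (simp add: vertices_def extreme_point_of_def)
    then have "c \<bullet> i \<le> b" using le by blast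
    with i b show "(i \<in> \<sigma> \<longrightarrow> i \<bullet> (1 / b) *\<^sub>R c = 1) \<and> (i \<notin> \<sigma> \<longrightarrow> i \<bullet> (1 / b) *\<^sub>R c < 1)"
      by (auto simp: eq inner_commute field_simps)
  qed
  then show "\<exists>a. is_facet_normal P \<sigma> a" ..
  fix a a' assume n: "is_facet_normal P \<sigma> a" "is_facet_normal P \<sigma> a'"
  have face: "\<sigma> face_of P" using fo by (rule facet_of_imp_face_of)
  have ne: "\<sigma> \<noteq> {}" using fo by (simp add: facet_of_def)
  have "compact \<sigma>" "convex \<sigma>"
    using face_of_polytope_polytope[OF P face] polytope_imp_compact polytope_imp_convex by auto
  then have hull: "\<sigma> = convex hull {x. x extreme_point_of \<sigma>}" by (rule Krein_Milman_Minkowski)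
  have dim: "aff_dim \<sigma> = DIM(real ^ 'd) - 1"
    using fo 0 aff_dim_nonempty_interior[of P] by (auto simp: facet_of_def)
  have *: "affine hull \<sigma> = {x. d \<bullet> x = 1} \<and> d \<noteq> 0" if d: "is_facet_normal P \<sigma> d" for d
  proof -
    have "{x. x extreme_point_of \<sigma>} \<subseteq> {x. d \<bullet> x = 1}"
      using d extreme_point_of_face[OF face]
      by (auto simp: is_facet_normal_def vertices_def inner_commute)
    then have "\<sigma> \<subseteq> {x. d \<bullet> x = 1}"
      using hull by (metis convex_hyperplane subset_hull)
    then have sub: "affine hull \<sigma> \<subseteq> {x. d \<bullet> x = 1}"
      by (metis affine_hyperplane subset_hull)
    have d0: "d \<noteq> 0" using \<open>\<sigma> \<subseteq> {x. d \<bullet> x = 1}\<close> ne by auto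
    moreover have "affine hull \<sigma> = {x. d \<bullet> x = 1}"
      using d0 dim ne by (intro affine_dim_equal sub affine_hyperplane) (auto simp: aff_dim_hyperplane)
    ultimately show ?thesis by simp
  qed
  have H: "{x. a \<bullet> x = 1} = {x. a' \<bullet> x = 1}" and "a \<noteq> 0" "a' \<noteq> 0"
    using *[OF n(1)] *[OF n(2)] by auto
  then have "(1 / (a \<bullet> a)) *\<^sub>R a \<in> {x. a' \<bullet> x = 1}" "(1 / (a' \<bullet> a')) *\<^sub>R a' \<in> {x. a \<bullet> x = 1}"
    by (metis (mono_tags, lifting) inner_eq_zero_iff inner_scaleR_right mem_Collect_eq nonzero_eq_divide_eq
        times_divide_eq_left mult_1)+
  then have "a' \<bullet> a = a \<bullet> a" "a \<bullet> a' = a' \<bullet> a'"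
    using \<open>a \<noteq> 0\<close> \<open>a' \<noteq> 0\<close> by (auto simp: field_simps)
  then have "(a - a') \<bullet> (a - a') = 0"
    by (simp add: inner_diff_left inner_diff_right)
  then show "a = a'" by simp
qed


section \<open>The rigidity matrix\<close>

text \<open>
  Rows are indexed by \<open>E\<close> and the incident pairs, columns by the coordinates of
  \<open>\<real>\<^sup>d\<^sup>V \<oplus> \<real>\<^sup>d\<^sup>F\<close>.
\<close>

type_synonym 'd row = "(real ^ 'd) set + (real ^ 'd) \<times> (real ^ 'd) set"
type_synonym 'd col = "(real ^ 'd) \<times> 'd + (real ^ 'd) set \<times> 'd"

definition row_indices :: "(real ^ 'd) set \<Rightarrow> 'd row set" where
  "row_indices P = edges P <+> incidences P"

definition col_indices :: "(real ^ 'd) set \<Rightarrow> ('d::finite) col set" where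
  "col_indices P = (vertices P \<times> UNIV) <+> (facets P \<times> UNIV)"

text \<open>The choice of an ordering of the end points of an edge is immaterial, see
  \<open>rigidity_map_edge\<close>.\<close>

definition rigidity_map ::
  "(real ^ 'd \<Rightarrow> real ^ 'd) \<Rightarrow> ((real ^ 'd) set \<Rightarrow> real ^ 'd) \<Rightarrow>
   (real ^ 'd \<Rightarrow> real ^ 'd) \<Rightarrow> ((real ^ 'd) set \<Rightarrow> real ^ 'd) \<Rightarrow> ('d::finite) row \<Rightarrow> real" where
  "rigidity_map q b p' a' r =
     (case r of
        Inl e \<Rightarrow> (let (i, j) = (SOME (i, j). e = {i, j}) in (q i - q j) \<bullet> (p' i - p' j))
      | Inr (i, \<sigma>) \<Rightarrow> q i \<bullet> a' \<sigma> + p' i \<bullet> b \<sigma>)"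

fun unit_p :: "('d::finite) col \<Rightarrow> real ^ 'd \<Rightarrow> real ^ 'd" where
  "unit_p (Inl (i, k)) = (\<lambda>j. if j = i then axis k 1 else 0)"
| "unit_p (Inr _) = (\<lambda>_. 0)"

fun unit_a :: "('d::finite) col \<Rightarrow> (real ^ 'd) set \<Rightarrow> real ^ 'd" where
  "unit_a (Inl _) = (\<lambda>_. 0)"
| "unit_a (Inr (\<sigma>, k)) = (\<lambda>\<tau>. if \<tau> = \<sigma> then axis k 1 else 0)"

definition rigidity_matrix ::
  "(real ^ 'd \<Rightarrow> real ^ 'd) \<Rightarrow> ((real ^ 'd) set \<Rightarrow> real ^ 'd) \<Rightarrow> ('d::finite) row \<Rightarrow> 'd col \<Rightarrow> real" where
  "rigidity_matrix q b r c = rigidity_map q b (unit_p c) (unit_a c) r"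

fun coords ::
  "(real ^ 'd \<Rightarrow> real ^ 'd) \<Rightarrow> ((real ^ 'd) set \<Rightarrow> real ^ 'd) \<Rightarrow> ('d::finite) col \<Rightarrow> real" where
  "coords p' a' (Inl (i, k)) = p' i $ k"
| "coords p' a' (Inr (\<sigma>, k)) = a' \<sigma> $ k"

definition mat_vec :: "(real ^ 'd) set \<Rightarrow> (('d::finite) row \<Rightarrow> 'd col \<Rightarrow> real) \<Rightarrow>
    ('d col \<Rightarrow> real) \<Rightarrow> 'd row \<Rightarrow> real" where
  "mat_vec P M x r = (\<Sum>c\<in>col_indices P. M r c * x c)"

definition transpose_vec :: "(real ^ 'd) set \<Rightarrow> (('d::finite) row \<Rightarrow> 'd col \<Rightarrow> real) \<Rightarrow>
    ('d row \<Rightarrow> real) \<Rightarrow> 'd col \<Rightarrow> real" where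
  "transpose_vec P M \<xi> c = (\<Sum>r\<in>row_indices P. M r c * \<xi> r)"

lemma rigidity_map_edge:
  "rigidity_map q b p' a' (Inl {i, j}) = (q i - q j) \<bullet> (p' i - p' j)"
proof -
  define u where "u = (SOME (k, l). {i, j} = {k, l})"
  have "case u of (k, l) \<Rightarrow> {i, j} = {k, l}"
    unfolding u_def by (rule someI[of _ "(i, j)"]) simp
  then have "u = (i, j) \<or> u = (j, i)" by (cases u) (auto simp: doubleton_eq_iff)
  moreover have "rigidity_map q b p' a' (Inl {i, j}) = (let (k, l) = u in (q k - q l) \<bullet> (p' k - p' l))"
    by (simp only: rigidity_map_def sum.case u_def)
  ultimately show ?thesis
    by (auto simp: inner_diff_left inner_diff_right)
qed

lemma rigidity_map_incidence:
  "rigidity_map q b p' a' (Inr (i, \<sigma>)) = q i \<bullet> a' \<sigma> + p' i \<bullet> b \<sigma>"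
  by (simp add: rigidity_map_def)

lemma mat_vec_rigidity_matrix:
  fixes P :: "(real ^ 'd) set"
  assumes P: "polytope P" and r: "r \<in> row_indices P"
  shows "mat_vec P (rigidity_matrix q b) (coords p' a') r = rigidity_map q b p' a' r"
proof -
  note fin = finite_vertices[OF P] finite_facets[OF P]
  have split: "mat_vec P (rigidity_matrix q b) (coords p' a') r =
      (\<Sum>i\<in>vertices P. \<Sum>k\<in>UNIV. rigidity_map q b (\<lambda>j. if j = i then axis k 1 else 0) (\<lambda>_. 0) r * p' i $ k)
    + (\<Sum>\<sigma>\<in>facets P. \<Sum>k\<in>UNIV. rigidity_map q b (\<lambda>_. 0) (\<lambda>\<tau>. if \<tau> = \<sigma> then axis k 1 else 0) r * a' \<sigma> $ k)"
    using fin
    by (auto simp: mat_vec_def col_indices_def rigidity_matrix_def sum.Plus sum.cartesian_product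
        intro!: arg_cong2[of _ _ _ _ "(+)"] sum.cong)
  have pull: "(\<Sum>k\<in>UNIV. (w \<bullet> axis k (1::real)) * z $ k) = w \<bullet> z" for w z :: "real ^ 'd"
    by (simp add: inner_axis) (simp add: inner_vec_def)
  have pick: "(\<Sum>i\<in>vertices P. \<Sum>k\<in>UNIV. (w \<bullet> (if j = i then axis k 1 else 0)) * z i $ k) = w \<bullet> z j"
    if "j \<in> vertices P" for w :: "real ^ 'd" and z j
  proof -
    have "(\<Sum>i\<in>vertices P. \<Sum>k\<in>UNIV. (w \<bullet> (if j = i then axis k 1 else 0)) * z i $ k)
        = (\<Sum>i\<in>vertices P. if j = i then w \<bullet> z i else 0)"
      by (rule sum.cong) (auto simp: pull)
    then show ?thesis using that fin by simp
  qed
  have pickF: "(\<Sum>\<tau>\<in>facets P. \<Sum>k\<in>UNIV. (w \<bullet> (if \<sigma> = \<tau> then axis k 1 else 0)) * z \<tau> $ k) = w \<bullet> z \<sigma>"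
    if "\<sigma> \<in> facets P" for w :: "real ^ 'd" and z \<sigma>
  proof -
    have "(\<Sum>\<tau>\<in>facets P. \<Sum>k\<in>UNIV. (w \<bullet> (if \<sigma> = \<tau> then axis k 1 else 0)) * z \<tau> $ k)
        = (\<Sum>\<tau>\<in>facets P. if \<sigma> = \<tau> then w \<bullet> z \<tau> else 0)"
      by (rule sum.cong) (auto simp: pull)
    then show ?thesis using that fin by simp
  qed
  from r consider (edge) i j where "r = Inl {i, j}" "i \<in> vertices P" "j \<in> vertices P"
    | (inc) i \<sigma> where "r = Inr (i, \<sigma>)" "i \<in> vertices P" "\<sigma> \<in> facets P"
    by (auto simp: row_indices_def edges_def incidences_def)
  then show ?thesis
  proof cases
    case edge
    then show ?thesis
      unfolding split
      by (simp add: rigidity_map_edge inner_diff_right[of "q i - q j"] left_diff_distrib sum_subtractf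
          pick)
  next
    case inc
    have c: "(if i = i' then axis k 1 else 0) \<bullet> b \<sigma> = b \<sigma> \<bullet> (if i = i' then axis k 1 else 0)" for i' k
      by (rule inner_commute)
    from inc show ?thesis
      unfolding split by (simp add: rigidity_map_incidence c pick pickF inner_commute)
  qed
qed


section \<open>Motions, flexes and stresses\<close>

abbreviation rigidity_matrix_of :: "(real ^ 'd) set \<Rightarrow> ('d::finite) row \<Rightarrow> 'd col \<Rightarrow> real" where
  "rigidity_matrix_of P \<equiv> rigidity_matrix (\<lambda>i. i) (facet_normal P)"

definition first_order_motion ::
  "(real ^ 'd) set \<Rightarrow> (real ^ 'd \<Rightarrow> real ^ 'd) \<Rightarrow> ((real ^ 'd) set \<Rightarrow> real ^ 'd) \<Rightarrow> bool" where
  "first_order_motion P p' a' \<longleftrightarrow>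
     (\<forall>r\<in>row_indices P. mat_vec P (rigidity_matrix_of P) (coords p' a') r = 0)"

definition trivial_motion ::
  "(real ^ 'd) set \<Rightarrow> (real ^ 'd \<Rightarrow> real ^ 'd) \<Rightarrow> ((real ^ 'd) set \<Rightarrow> real ^ 'd) \<Rightarrow> bool" where
  "trivial_motion P p' a' \<longleftrightarrow>
     (\<forall>i\<in>vertices P. \<forall>j\<in>vertices P. (i - j) \<bullet> (p' i - p' j) = 0)"

definition first_order_flex ::
  "(real ^ 'd) set \<Rightarrow> (real ^ 'd \<Rightarrow> real ^ 'd) \<Rightarrow> ((real ^ 'd) set \<Rightarrow> real ^ 'd) \<Rightarrow> bool" where
  "first_order_flex P p' a' \<longleftrightarrow> first_order_motion P p' a' \<and> \<not> trivial_motion P p' a'"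

definition first_order_rigid :: "(real ^ 'd) set \<Rightarrow> bool" where
  "first_order_rigid P \<longleftrightarrow> (\<nexists>p' a'. first_order_flex P p' a')"

definition equilibrium_stress :: "(real ^ 'd) set \<Rightarrow> (('d::finite) row \<Rightarrow> real) \<Rightarrow> bool" where
  "equilibrium_stress P \<xi> \<longleftrightarrow> (\<forall>c\<in>col_indices P. transpose_vec P (rigidity_matrix_of P) \<xi> c = 0)"

definition blocks ::
  "(real ^ 'd) set \<Rightarrow> (('d::finite) row \<Rightarrow> real) \<Rightarrow>
   (real ^ 'd \<Rightarrow> real ^ 'd) \<Rightarrow> ((real ^ 'd) set \<Rightarrow> real ^ 'd) \<Rightarrow> bool" where
  "blocks P \<xi> p' a' \<longleftrightarrow>
     (\<Sum>r\<in>row_indices P. \<xi> r * mat_vec P (rigidity_matrix p' a') (coords p' a') r) \<noteq> 0"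

definition prestress_stable :: "(real ^ 'd) set \<Rightarrow> bool" where
  "prestress_stable P \<longleftrightarrow>
     (\<exists>\<xi>. equilibrium_stress P \<xi> \<and> (\<forall>p' a'. first_order_flex P p' a' \<longrightarrow> blocks P \<xi> p' a'))"

definition second_order_motion ::
  "(real ^ 'd) set \<Rightarrow> (real ^ 'd \<Rightarrow> real ^ 'd) \<Rightarrow> ((real ^ 'd) set \<Rightarrow> real ^ 'd) \<Rightarrow>
   (real ^ 'd \<Rightarrow> real ^ 'd) \<Rightarrow> ((real ^ 'd) set \<Rightarrow> real ^ 'd) \<Rightarrow> bool" where
  "second_order_motion P p' a' p'' a'' \<longleftrightarrow>
     first_order_motion P p' a' \<and>
     (\<forall>i j. {i, j} \<in> edges P \<longrightarrow>
        (i - j) \<bullet> (p'' i - p'' j) + (p' i - p' j) \<bullet> (p' i - p' j) = 0) \<and>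
     (\<forall>(i, \<sigma>)\<in>incidences P.
        i \<bullet> a'' \<sigma> + 2 * (p' i \<bullet> a' \<sigma>) + p'' i \<bullet> facet_normal P \<sigma> = 0)"

definition second_order_rigid :: "(real ^ 'd) set \<Rightarrow> bool" where
  "second_order_rigid P \<longleftrightarrow>
     (\<forall>p' a' p'' a''. second_order_motion P p' a' p'' a'' \<longrightarrow> trivial_motion P p' a')"

end

theory Submission
  imports Defs
begin

text \<open>
  If \<open>P\<close> is first-order rigid, there is nothing to block and the zero stress is enough.
  For the second implication, a second-order motion satisfies \<open>R(P) P'' = - R(P') P'\<close>. Pairing with
  an equilibrium stress \<open>\<xi>\<close> annihilates the left-hand side, so \<open>\<xi>\<close> does not block \<open>P'\<close>.
\<close>

text \<open>Exchanging the two sums turns the matrix acting on \<open>x\<close> into its transpose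
  acting on \<open>\<xi>\<close>. Here \<open>x\<close> is any column vector, so the fact applies to
  accelerations, which need not form a first-order motion.\<close>

lemma equilibrium_stress_orthogonal:
  assumes "equilibrium_stress P \<xi>"
  shows "(\<Sum>r\<in>row_indices P. \<xi> r * mat_vec P (rigidity_matrix_of P) x r) = 0"
proof -
  have "(\<Sum>r\<in>row_indices P. \<xi> r * mat_vec P (rigidity_matrix_of P) x r)
      = (\<Sum>c\<in>col_indices P. x c * transpose_vec P (rigidity_matrix_of P) \<xi> c)"
    unfolding mat_vec_def transpose_vec_def sum_distrib_left
    by (subst sum.swap) (simp add: mult_ac)
  also have "\<dots> = 0"
    using assms by (simp add: equilibrium_stress_def)
  finally show ?thesis .
qed

text \<open>With \<open>(p', a')\<close> both as matrix entries and as argument, an incidence row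
  gives \<open>p' i \<bullet> a' \<sigma>\<close> twice, which accounts for the factor 2 in the
  second-order condition; an edge row gives its square only once.\<close>

lemma second_order_motion_mat_vec:
  fixes P :: "(real ^ 'd) set"
  assumes P: "polytope P" and m: "second_order_motion P p' a' p'' a''" and r: "r \<in> row_indices P"
  shows "mat_vec P (rigidity_matrix p' a') (coords p' a') r
      = - mat_vec P (rigidity_matrix_of P) (coords p'' a'') r"
proof -
  from r consider (edge) i j where "r = Inl {i, j}" "{i, j} \<in> edges P"
    | (inc) i \<sigma> where "r = Inr (i, \<sigma>)" "(i, \<sigma>) \<in> incidences P"
    by (auto simp: row_indices_def edges_def)
  \<comment> \<open>The comparison is made on the linear map, where each row is an explicit formula,
    and carried back to the matrices at the end.\<close>
  then have "rigidity_map p' a' p' a' r = - rigidity_map (\<lambda>i. i) (facet_normal P) p'' a'' r"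
  proof cases
    case edge
    with m have "(i - j) \<bullet> (p'' i - p'' j) + (p' i - p' j) \<bullet> (p' i - p' j) = 0"
      unfolding second_order_motion_def by blast
    then show ?thesis
      unfolding edge(1) rigidity_map_edge by linarith
  next
    case inc
    with m have "i \<bullet> a'' \<sigma> + 2 * (p' i \<bullet> a' \<sigma>) + p'' i \<bullet> facet_normal P \<sigma> = 0"
      unfolding second_order_motion_def by blast
    then show ?thesis
      unfolding inc(1) rigidity_map_incidence by linarith
  qed
  then show ?thesis
    by (simp add: mat_vec_rigidity_matrix[OF P r])
qed

lemma second_order_motion_not_blocked:
  fixes P :: "(real ^ 'd) set"
  assumes "polytope P" and "second_order_motion P p' a' p'' a''" and "equilibrium_stress P \<xi>"
  shows "\<not> blocks P \<xi> p' a'"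
  using equilibrium_stress_orthogonal[OF assms(3), of "coords p'' a''"]
  by (simp add: blocks_def second_order_motion_mat_vec[OF assms(1,2)] sum_negf)

lemma first_order_rigid_imp_prestress_stable:
  "first_order_rigid P \<Longrightarrow> prestress_stable P"
  unfolding first_order_rigid_def prestress_stable_def
  by (intro exI[of _ "\<lambda>_. 0"]) (simp add: equilibrium_stress_def transpose_vec_def)

text \<open>A non-trivial second-order motion would have a flex as its first-order part; the
  stabilizing stress would have to block that flex, yet no equilibrium stress can.\<close>

lemma prestress_stable_imp_second_order_rigid:
  fixes P :: "(real ^ 'd) set"
  assumes "polytope P" and "prestress_stable P"
  shows "second_order_rigid P"
  using assms(2) second_order_motion_not_blocked[OF assms(1)]
  unfolding prestress_stable_def second_order_rigid_def first_order_flex_def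
  by (meson second_order_motion_def)

theorem corollary4p3:
  fixes P :: "(real ^ 'd) set"
  assumes "polytope P" and "aff_dim P = int CARD('d)" and "0 \<in> interior P"
  shows "(first_order_rigid P \<longrightarrow> prestress_stable P) \<and>
         (prestress_stable P \<longrightarrow> second_order_rigid P)"
  using first_order_rigid_imp_prestress_stable
    prestress_stable_imp_second_order_rigid[OF assms(1)] by blast

end
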